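(* Let $D$ be a connected weighted oriented graph with $V(D)=\{x_1,\ldots,x_t\}$ and underlying simple graph $G$, and suppose $I(D)\neq I(G)$, where both ideals are taken in $S=K[x_1,\ldots,x_t]$, $K$ a field. If $I(D)$ has a linear resolution, then $\mathrm v(I(D)^k)=\alpha(I(D))k-1$ for all $k\geq 1$.
   Context: $S=\bigoplus_{d\ge 0}S_d$ is graded with $\deg x_i=1$; vertices are identified with variables. A weighted oriented graph $D$ with underlying finite simple graph $G$ is a triple $(V(D),E(D),w)$ where $V(D)=V(G)$, $E(D)\subseteq V(D)\times V(D)$ is obtained by choosing exactly one direction for each edge of $G$ (so $\{\{x,y\}\mid (x,y)\in E(D)\}=E(G)$; $(x,y)\in E(D)$ means an edge directed from $x$ to $y$), and $w:V(D)\to\mathbb{N}=\{1,2,\ldots\}$ is a weight function. $D$ is connected if $G$ is. The edge ideal of $D$ is $I(D)=\langle x_ix_j^{w(x_j)}\mid (x_i,x_j)\in E(D)\rangle$, and the edge ideal of $G$ is $I(G)=\langle x_ix_j\mid\{x_i,x_j\}\in E(G)\rangle$. For a nonzero graded ideal $I$, $\alpha(I):=\min\{\deg(f)\mid f\in I\setminus\{0\}\}$ (over homogeneous $f$). An equigenerated graded ideal $I$ (generated by homogeneous elements of a single degree) has a linear resolution if its Castelnuovo–Mumford regularity satisfies $\operatorname{reg}(I)=\alpha(I)$. For a proper graded ideal $I$, $\mathrm{v}(I):=\min\{d\geq 0\mid \exists f\in S_d,\ \mathfrak{p}\in\operatorname{Ass}(I)\text{ with }(I:f)=\mathfrak{p}\}$,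 where $\operatorname{Ass}(I)$ is the set of associated primes of $S/I$ and $(I:f)=\{g\in S\mid gf\in I\}$. *)

theory Defs
  imports
    Complex_Main
    "HOL-Library.Poly_Mapping"
    "Jordan_Normal_Form.Matrix_Kernel"
begin

section \<open>The graded polynomial ring\<close>

text \<open>The variables are indexed by a type \<open>'v\<close>; with \<open>'v\<close> finite, \<open>('v, 'k) mpoly\<close> is
  $K[x_1,\dots,x_t]$ with $t$ the number of elements of \<open>'v\<close>. Multiplication is the convolution
  product that the library puts on finitely supported functions.\<close>

type_synonym ('v, 'k) mpoly = "('v \<Rightarrow>\<^sub>0 nat) \<Rightarrow>\<^sub>0 'k"

definition Var :: "'v \<Rightarrow> ('v, 'k::comm_ring_1) mpoly" where
  "Var x = Poly_Mapping.single (Poly_Mapping.single x 1) 1"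

definition monom_degree :: "('v::finite \<Rightarrow>\<^sub>0 nat) \<Rightarrow> nat" where
  "monom_degree m = (\<Sum>x\<in>UNIV. Poly_Mapping.lookup m x)"

definition homogeneous_part :: "nat \<Rightarrow> ('v::finite, 'k::comm_ring_1) mpoly set" where
  "homogeneous_part d = {f. \<forall>m\<in>Poly_Mapping.keys f. monom_degree m = d}"

section \<open>Ideals\<close>

text \<open>Ideals are the submodules of the ring: \<open>ideals.subspace I\<close> says that \<open>I\<close> is an ideal, and
  \<open>ideals.span B\<close> is the ideal generated by \<open>B\<close>.\<close>

global_interpretation ideals: module "(*) :: 'a \<Rightarrow> 'a \<Rightarrow> 'a::comm_ring_1"
  by unfold_locales (simp_all add: algebra_simps)

definition prime_ideal :: "'a::comm_ring_1 set \<Rightarrow> bool" where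
  "prime_ideal P \<longleftrightarrow> ideals.subspace P \<and> P \<noteq> UNIV \<and> (\<forall>a b. a * b \<in> P \<longrightarrow> a \<in> P \<or> b \<in> P)"

definition ideal_product :: "'a::comm_ring_1 set \<Rightarrow> 'a set \<Rightarrow> 'a set" where
  "ideal_product I J = ideals.span {a * b | a b. a \<in> I \<and> b \<in> J}"

primrec ideal_power :: "'a::comm_ring_1 set \<Rightarrow> nat \<Rightarrow> 'a set" where
  "ideal_power I 0 = UNIV"
| "ideal_power I (Suc k) = ideal_product I (ideal_power I k)"

definition colon :: "'a::comm_ring_1 set \<Rightarrow> 'a \<Rightarrow> 'a set" where
  "colon I f = {g. g * f \<in> I}"

text \<open>The annihilator of the class of \<open>f\<close> in $S/I$ is \<open>colon I f\<close>, so this is the set of primes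
  that are annihilators of elements of $S/I$.\<close>

definition Ass :: "'a::comm_ring_1 set \<Rightarrow> 'a set set" where
  "Ass I = {P. prime_ideal P \<and> (\<exists>f. P = colon I f)}"

definition v_number :: "('v::finite, 'k::comm_ring_1) mpoly set \<Rightarrow> nat" where
  "v_number I = (LEAST d. \<exists>f\<in>homogeneous_part d. \<exists>P\<in>Ass I. colon I f = P)"

definition alpha :: "('v::finite, 'k::comm_ring_1) mpoly set \<Rightarrow> nat" where
  "alpha I = (LEAST d. \<exists>f\<in>homogeneous_part d. f \<in> I \<and> f \<noteq> 0)"

definition equigenerated :: "('v::finite, 'k::comm_ring_1) mpoly set \<Rightarrow> bool" where
  "equigenerated I \<longleftrightarrow> (\<exists>d B. B \<subseteq> homogeneous_part d \<and> I = ideals.span B)"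

section \<open>Minimal graded free resolutions and regularity\<close>

text \<open>A matrix \<open>A\<close> defines a degree-preserving map
  $\bigoplus_j S(-c_j) \to \bigoplus_i S(-r_i)$ iff its entry at \<open>(i, j)\<close> is homogeneous of
  degree $c_j - r_i$; it must vanish if this number is negative.\<close>

definition graded_mat ::
  "(nat \<Rightarrow> nat) \<Rightarrow> (nat \<Rightarrow> nat) \<Rightarrow> ('v::finite, 'k::comm_ring_1) mpoly mat \<Rightarrow> bool" where
  "graded_mat r c A \<longleftrightarrow> (\<forall>i<dim_row A. \<forall>j<dim_col A.
     A $$ (i, j) = 0 \<or> (r i \<le> c j \<and> A $$ (i, j) \<in> homogeneous_part (c j - r i)))"

definition mat_image :: "'a::comm_ring_1 mat \<Rightarrow> 'a vec set" where
  "mat_image A = (\<lambda>v. A *\<^sub>v v) ` carrier_vec (dim_col A)"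

text \<open>\<open>minimal_graded_free_resolution I b s \<epsilon> \<delta>\<close>: the exact complex
  \[ \cdots \to F_2 \to F_1 \to F_0 \to I \to 0, \qquad
     F_i = \bigoplus_{j < b_i} S(-s_{i,j}), \]
  with \<open>\<epsilon>\<close> (a row of length \<open>b 0\<close>) the matrix of $F_0 \to I \subseteq S$ and \<open>\<delta> i\<close> the
  matrix of $F_{i+1} \to F_i$. All maps preserve degrees, and minimality says that
  $\delta_i(F_{i+1}) \subseteq (x_1,\dots,x_t) F_i$. The complex is allowed to be infinite, with
  \<open>b i = 0\<close> for $F_i = 0$. Natural numbers suffice for the shifts, because a minimal resolution of
  an ideal of \<open>S\<close> has no negative ones.\<close>

definition minimal_graded_free_resolution ::
  "('v::finite, 'k::field) mpoly set \<Rightarrow> (nat \<Rightarrow> nat) \<Rightarrow> (nat \<Rightarrow> nat \<Rightarrow> nat)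
     \<Rightarrow> ('v, 'k) mpoly mat \<Rightarrow> (nat \<Rightarrow> ('v, 'k) mpoly mat) \<Rightarrow> bool" where
  "minimal_graded_free_resolution I b s \<epsilon> \<delta> \<longleftrightarrow>
     \<epsilon> \<in> carrier_mat 1 (b 0) \<and> (\<forall>i. \<delta> i \<in> carrier_mat (b i) (b (Suc i))) \<and>
     graded_mat (\<lambda>_. 0) (s 0) \<epsilon> \<and> (\<forall>i. graded_mat (s i) (s (Suc i)) (\<delta> i)) \<and>
     (\<lambda>v. v $ 0) ` mat_image \<epsilon> = I \<and>
     mat_image (\<delta> 0) = mat_kernel \<epsilon> \<and>
     (\<forall>i. mat_image (\<delta> (Suc i)) = mat_kernel (\<delta> i)) \<and>
     (\<forall>i. \<forall>l<b i. \<forall>j<b (Suc i). \<delta> i $$ (l, j) \<in> ideals.span (range Var))"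

text \<open>Castelnuovo--Mumford regularity, $\operatorname{reg}(I) = \max\{j - i \mid \beta_{i,j}(I) \ne 0\}$,
  where the graded Betti number $\beta_{i,j}(I)$ is the number of summands $S(-j)$ of $F_i$ in the
  minimal graded free resolution of \<open>I\<close>. It is given as a relation between \<open>I\<close> and its
  regularity; by uniqueness of the minimal resolution up to isomorphism, the resolution chosen
  does not matter, and the relation is the graph of the function $\operatorname{reg}$ on nonzero
  graded ideals.\<close>

definition graded_betti :: "(nat \<Rightarrow> nat) \<Rightarrow> (nat \<Rightarrow> nat \<Rightarrow> nat) \<Rightarrow> nat \<Rightarrow> nat \<Rightarrow> nat" where
  "graded_betti b s i j = card {l. l < b i \<and> s i l = j}"

definition has_regularity :: "('v::finite, 'k::field) mpoly set \<Rightarrow> int \<Rightarrow> bool" where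
  "has_regularity I r \<longleftrightarrow> (\<exists>b s \<epsilon> \<delta>. minimal_graded_free_resolution I b s \<epsilon> \<delta> \<and>
     (\<exists>i j. graded_betti b s i j \<noteq> 0 \<and> r = int j - int i) \<and>
     (\<forall>i j. graded_betti b s i j \<noteq> 0 \<longrightarrow> int j - int i \<le> r))"

definition has_linear_resolution :: "('v::finite, 'k::field) mpoly set \<Rightarrow> bool" where
  "has_linear_resolution I \<longleftrightarrow> equigenerated I \<and> has_regularity I (int (alpha I))"

section \<open>Weighted oriented graphs and edge ideals\<close>

text \<open>The vertex set is the whole type \<open>'v\<close>, so that vertices are identified with variables.
  A simple graph is given by its set of edges, which are two-element sets of vertices.\<close>

definition simple_graph :: "'v set set \<Rightarrow> bool" where
  "simple_graph G \<longleftrightarrow> (\<forall>e\<in>G. card e = 2)"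

definition connected_graph :: "'v set set \<Rightarrow> bool" where
  "connected_graph G \<longleftrightarrow> (\<forall>x y. (x, y) \<in> {(u, v). {u, v} \<in> G}\<^sup>*)"

definition weighted_oriented_graph ::
  "'v set set \<Rightarrow> ('v \<times> 'v) set \<Rightarrow> ('v \<Rightarrow> nat) \<Rightarrow> bool" where
  "weighted_oriented_graph G E w \<longleftrightarrow> simple_graph G \<and>
     {{x, y} | x y. (x, y) \<in> E} = G \<and>
     (\<forall>x y. (x, y) \<in> E \<longrightarrow> (y, x) \<notin> E) \<and>
     (\<forall>x. w x \<ge> 1)"

definition edge_ideal :: "'v set set \<Rightarrow> ('v, 'k::comm_ring_1) mpoly set" where
  "edge_ideal G = ideals.span {Var x * Var y | x y. {x, y} \<in> G}"

definition oriented_edge_ideal ::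
  "('v \<times> 'v) set \<Rightarrow> ('v \<Rightarrow> nat) \<Rightarrow> ('v, 'k::comm_ring_1) mpoly set" where
  "oriented_edge_ideal E w = ideals.span {Var x * Var y ^ w y | x y. (x, y) \<in> E}"

end

theory Submission
  imports Defs
begin

text \<open>Write \<open>W = alpha I - 1\<close>. The edge monomials $x_i x_j^{w(x_j)}$ form an antichain under
  divisibility, so they are the minimal generators of \<open>I\<close>; as \<open>I\<close> is equigenerated, they all have
  degree \<open>W + 1\<close>, that is, every head of an edge has weight \<open>W\<close>
  (\<open>alpha_oriented_edge_ideal\<close>). Since \<open>I\<close> is not the edge ideal of \<open>G\<close>, moreover \<open>W \<ge> 2\<close>.

  The resolution enters only through \<open>linear_resolution_presentation\<close>: the syzygies between
  generators of degree \<open>alpha I\<close> are consequences of those with coefficients of degree at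
  most one. Because \<open>W \<ge> 2\<close>, two edge monomials with different heads have a least common
  multiple of degree more than \<open>W + 2\<close>, so linear syzygies cannot mix different heads. If two
  heads \<open>j \<noteq> l\<close> occurred, the part of \<open>I\<close> with head \<open>j\<close> would therefore split off as a direct
  summand, which is impossible in a ring where the product of two monomials is nonzero
  (\<open>linear_resolution_common_head\<close>). Hence all edges point to one vertex \<open>y\<close>, and
  $I = y^W (x \mid x \in N)$ for a nonempty set \<open>N\<close> of variables other than \<open>y\<close>.

  For such an ideal the v-number of $I^k$ is found directly (\<open>v_number_power_star_ideal\<close>). A prime
  $(I^k : f)$ contains a power of a generator of \<open>I\<close>, hence a variable \<open>z\<close>; then \<open>z f\<close> is a
  nonzero element of $I^k$ and has degree at least \<open>(W + 1) k\<close>. Conversely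
  $f = y^{Wk} x_i^{k-1}$ with $x_i \in N$ has degree \<open>(W + 1) k - 1\<close>, and $(I^k : f)$ is the prime
  ideal generated by \<open>N\<close>.\<close>

section \<open>Supports of polynomials\<close>

text \<open>The coefficient of a product at a monomial that splits in only one way is a product of two
  coefficients. This covers shifts by a monomial as well as products of leading terms.\<close>

lemma lookup_mult_unique:
  fixes f g :: "'a::comm_monoid_add \<Rightarrow>\<^sub>0 'b::comm_ring_1"
  assumes uniq: "\<And>a b. a \<in> Poly_Mapping.keys f \<Longrightarrow> b \<in> Poly_Mapping.keys g
      \<Longrightarrow> a + b = p + q \<Longrightarrow> a = p \<and> b = q"
  shows "Poly_Mapping.lookup (f * g) (p + q) = Poly_Mapping.lookup f p * Poly_Mapping.lookup g q"
proof -
  define f' where "f' = f - Poly_Mapping.single p (Poly_Mapping.lookup f p)"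
  define g' where "g' = g - Poly_Mapping.single q (Poly_Mapping.lookup g q)"
  have kf: "a \<in> Poly_Mapping.keys f \<and> a \<noteq> p" if "a \<in> Poly_Mapping.keys f'" for a
    using that by (auto simp: f'_def in_keys_iff lookup_minus lookup_single when_def split: if_splits)
  have kg: "a \<in> Poly_Mapping.keys g \<and> a \<noteq> q" if "a \<in> Poly_Mapping.keys g'" for a
    using that by (auto simp: g'_def in_keys_iff lookup_minus lookup_single when_def split: if_splits)
  have 1: "Poly_Mapping.lookup (f' * g) (p + q) = 0"
  proof (rule ccontr)
    assume "\<not> ?thesis"
    then have "p + q \<in> Poly_Mapping.keys (f' * g)" by (simp add: in_keys_iff)
    then obtain a b where "a \<in> Poly_Mapping.keys f'" "b \<in> Poly_Mapping.keys g" "p + q = a + b"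
      using keys_mult by blast
    then show False using kf uniq by metis
  qed
  have 2: "Poly_Mapping.lookup (Poly_Mapping.single p (Poly_Mapping.lookup f p) * g') (p + q) = 0"
  proof (cases "p \<in> Poly_Mapping.keys f")
    case True
    show ?thesis
    proof (rule ccontr)
      assume "\<not> ?thesis"
      then have "p + q \<in> Poly_Mapping.keys (Poly_Mapping.single p (Poly_Mapping.lookup f p) * g')"
        by (simp add: in_keys_iff)
      then obtain b where "b \<in> Poly_Mapping.keys g'" "p + q = p + b"
        using keys_mult by (fastforce split: if_splits)
      then show False using kg uniq True by metis
    qed
  qed (simp add: in_keys_iff)
  have "f * g = f' * g + Poly_Mapping.single p (Poly_Mapping.lookup f p) * g'
      + Poly_Mapping.single (p + q) (Poly_Mapping.lookup f p * Poly_Mapping.lookup g q)"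
    by (simp add: f'_def g'_def algebra_simps mult_single)
  then show ?thesis by (simp add: lookup_add 1 2)
qed

lemma lookup_monomial_times:
  fixes f :: "'a::cancel_comm_monoid_add \<Rightarrow>\<^sub>0 'b::comm_ring_1"
  shows "Poly_Mapping.lookup (Poly_Mapping.single p 1 * f) (p + q) = Poly_Mapping.lookup f q"
  by (subst lookup_mult_unique) (auto split: if_splits)

text \<open>A set of monomials that is closed under multiples cuts out an ideal, so the monomials of the
  elements of an ideal can be controlled on its generators. All degree bounds and
  divisibility arguments below are instances.\<close>

lemma keys_ideal_span:
  fixes B :: "('a::comm_monoid_add \<Rightarrow>\<^sub>0 'b::comm_ring_1) set"
  assumes up: "\<And>m p. m \<in> U \<Longrightarrow> p + m \<in> U"
    and gen: "\<And>b. b \<in> B \<Longrightarrow> Poly_Mapping.keys b \<subseteq> U"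
    and f: "f \<in> ideals.span B"
  shows "Poly_Mapping.keys f \<subseteq> U"
  using f
proof (induction rule: ideals.span_induct_alt)
  case (step c x y)
  have "Poly_Mapping.keys (c * x) \<subseteq> U"
    using keys_mult[of c x] gen[OF step(1)] up by blast
  then show ?case using step keys_add[of "c * x" y] by blast
qed simp

text \<open>Applied below with the total degree and with the degree in the variables of \<open>N\<close> for
  \<open>\<omega>\<close>.\<close>

lemma keys_ideal_power:
  fixes I :: "('a::comm_monoid_add \<Rightarrow>\<^sub>0 'b::comm_ring_1) set" and \<omega> :: "'a \<Rightarrow> nat"
  assumes add: "\<And>m n. \<omega> (m + n) = \<omega> m + \<omega> n"
    and I: "\<And>f m. f \<in> I \<Longrightarrow> m \<in> Poly_Mapping.keys f \<Longrightarrow> c \<le> \<omega> m"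
    and "f \<in> ideal_power I k" "m \<in> Poly_Mapping.keys f"
  shows "c * k \<le> \<omega> m"
  using assms(3,4)
proof (induction k arbitrary: f m)
  case (Suc k)
  have "Poly_Mapping.keys f \<subseteq> {m. c * Suc k \<le> \<omega> m}"
  proof (rule keys_ideal_span)
    show "f \<in> ideals.span {a * b |a b. a \<in> I \<and> b \<in> ideal_power I k}"
      using Suc.prems(1) by (simp add: ideal_product_def)
  next
    fix h assume "h \<in> {a * b |a b. a \<in> I \<and> b \<in> ideal_power I k}"
    then obtain a b where h: "h = a * b" "a \<in> I" "b \<in> ideal_power I k" by blast
    show "Poly_Mapping.keys h \<subseteq> {m. c * Suc k \<le> \<omega> m}"
    proof
      fix m assume "m \<in> Poly_Mapping.keys h"
      then obtain p q where "p \<in> Poly_Mapping.keys a" "q \<in> Poly_Mapping.keys b" "m = p + q"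
        using keys_mult h(1) by blast
      then show "m \<in> {m. c * Suc k \<le> \<omega> m}"
        using I[OF h(2)] Suc.IH[OF h(3)] by (simp add: add add_mono)
    qed
  qed (simp add: add trans_le_add2)
  then show ?case using Suc.prems(2) by blast
qed simp

lemma power_in_ideal_power: "f \<in> I \<Longrightarrow> f ^ k \<in> ideal_power I k"
  by (induction k) (auto simp: ideal_product_def intro!: ideals.span_base)

lemma monom_degree_add: "monom_degree (m + n) = monom_degree m + monom_degree n"
  by (simp add: monom_degree_def lookup_add sum.distrib)

lemma monom_degree_single [simp]: "monom_degree (Poly_Mapping.single x n) = n"
  by (simp add: monom_degree_def lookup_single when_def)

lemma monom_degree_zero_iff: "monom_degree m = 0 \<longleftrightarrow> m = 0"
  by (auto simp: monom_degree_def poly_mapping_eq_iff fun_eq_iff)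

lemma monom_degree_zero: "monom_degree 0 = 0"
  by (simp add: monom_degree_def)

lemma lookup_add_le_monom_degree:
  assumes "x \<noteq> y"
  shows "Poly_Mapping.lookup m x + Poly_Mapping.lookup m y \<le> monom_degree m"
proof -
  have "Poly_Mapping.lookup m x + Poly_Mapping.lookup m y = (\<Sum>z\<in>{x, y}. Poly_Mapping.lookup m z)"
    using assms by simp
  also have "\<dots> \<le> monom_degree m"
    unfolding monom_degree_def by (rule sum_mono2) auto
  finally show ?thesis .
qed

lemma Var_power: "Var x ^ n = Poly_Mapping.single (Poly_Mapping.single x n) 1"
  by (induction n) (simp_all add: Var_def mult_single flip: single_add)

section \<open>Ideals generated by variables\<close>

lemma poly_mapping_sum_monomials:
  fixes f :: "'a \<Rightarrow>\<^sub>0 'b::comm_monoid_add"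
  shows "f = (\<Sum>m\<in>Poly_Mapping.keys f. Poly_Mapping.single m (Poly_Mapping.lookup f m))"
  by (rule poly_mapping_eqI)
    (simp add: lookup_sum lookup_single when_def in_keys_iff)

lemma in_variable_ideal_iff:
  fixes f :: "('v, 'k::comm_ring_1) mpoly"
  shows "f \<in> ideals.span (Var ` N)
    \<longleftrightarrow> (\<forall>m\<in>Poly_Mapping.keys f. \<exists>x\<in>N. Poly_Mapping.lookup m x \<noteq> 0)" (is "_ \<longleftrightarrow> ?R")
proof
  assume f: "f \<in> ideals.span (Var ` N)"
  have "Poly_Mapping.keys f \<subseteq> {m. \<exists>x\<in>N. Poly_Mapping.lookup m x \<noteq> 0}"
    by (rule keys_ideal_span[OF _ _ f]) (auto simp: Var_def lookup_add lookup_single when_def)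
  then show ?R by blast
next
  assume R: ?R
  have "Poly_Mapping.single m (Poly_Mapping.lookup f m) \<in> ideals.span (Var ` N)"
    if m: "m \<in> Poly_Mapping.keys f" for m
  proof -
    from R m obtain x where x: "x \<in> N" "Poly_Mapping.lookup m x \<noteq> 0" by blast
    have "m = (m - Poly_Mapping.single x 1) + Poly_Mapping.single x 1"
      by (rule poly_mapping_eqI) (use x in \<open>auto simp: lookup_add lookup_minus lookup_single when_def\<close>)
    then have "Poly_Mapping.single m (Poly_Mapping.lookup f m)
        = Poly_Mapping.single (m - Poly_Mapping.single x 1) (Poly_Mapping.lookup f m) * Var x"
      by (simp add: Var_def mult_single)
    then show ?thesis using x(1) by (metis ideals.span_scale ideals.span_base imageI)
  qed
  then show "f \<in> ideals.span (Var ` N)"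
    by (subst poly_mapping_sum_monomials) (rule ideals.span_sum)
qed

text \<open>The library orders \<open>nat \<Rightarrow>\<^sub>0 nat\<close> lexicographically, compatibly with addition. Numbering the
  variables transports this monomial order to an arbitrary finite set of variables.\<close>

lemma additive_monomial_order:
  obtains \<phi> :: "('v::finite \<Rightarrow>\<^sub>0 nat) \<Rightarrow> (nat \<Rightarrow>\<^sub>0 nat)"
  where "inj \<phi>" and "\<forall>m n. \<phi> (m + n) = \<phi> m + \<phi> n"
proof -
  obtain h :: "'v \<Rightarrow> nat" where h: "inj h"
    using finite_imp_inj_to_nat_seg[of "UNIV :: 'v set"] by auto
  define \<phi> :: "('v \<Rightarrow>\<^sub>0 nat) \<Rightarrow> (nat \<Rightarrow>\<^sub>0 nat)"
    where "\<phi> m = (\<Sum>x\<in>UNIV. Poly_Mapping.single (h x) (Poly_Mapping.lookup m x))" for m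
  have lk: "Poly_Mapping.lookup (\<phi> m) (h x) = Poly_Mapping.lookup m x" for m x
    using h by (simp add: \<phi>_def lookup_sum lookup_single when_def inj_eq)
  show thesis
  proof (rule that[of \<phi>])
    show "inj \<phi>"
      by (rule injI, rule poly_mapping_eqI) (metis lk)
    show "\<forall>m n. \<phi> (m + n) = \<phi> m + \<phi> n"
      by (simp add: \<phi>_def lookup_add single_add sum.distrib)
  qed
qed

text \<open>An element lies outside the ideal iff it has a monomial free of the variables in \<open>N\<close>. For two
  such elements, the product of their largest monomials of this kind cannot cancel: the factors
  of an \<open>N\<close>-free monomial are \<open>N\<close>-free themselves.\<close>

lemma prime_variable_ideal:
  "prime_ideal (ideals.span (Var ` N) :: ('v::finite, 'k::field) mpoly set)"
proof -
  let ?P = "ideals.span (Var ` N) :: ('v, 'k) mpoly set"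
  define F where "F = {m :: 'v \<Rightarrow>\<^sub>0 nat. \<forall>x\<in>N. Poly_Mapping.lookup m x = 0}"
  have P: "f \<in> ?P \<longleftrightarrow> Poly_Mapping.keys f \<inter> F = {}" for f
    by (auto simp: in_variable_ideal_iff F_def)
  have F: "m + n \<in> F \<longleftrightarrow> m \<in> F \<and> n \<in> F" for m n
    by (auto simp: F_def lookup_add)
  obtain \<phi> :: "('v \<Rightarrow>\<^sub>0 nat) \<Rightarrow> (nat \<Rightarrow>\<^sub>0 nat)"
    where \<phi>: "inj \<phi>" "\<forall>m n. \<phi> (m + n) = \<phi> m + \<phi> n"
    by (rule additive_monomial_order)
  have lead: "\<exists>m \<in> Poly_Mapping.keys f \<inter> F. \<forall>n \<in> Poly_Mapping.keys f \<inter> F. \<phi> n \<le> \<phi> m" if "f \<notin> ?P" for f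
  proof -
    have fin: "finite (\<phi> ` (Poly_Mapping.keys f \<inter> F))" "\<phi> ` (Poly_Mapping.keys f \<inter> F) \<noteq> {}"
      using that P by auto
    from Max_in[OF fin] Max_ge[OF fin(1)] show ?thesis
      by (metis (no_types, lifting) imageE imageI)
  qed
  have "a * b \<notin> ?P" if a: "a \<notin> ?P" and b: "b \<notin> ?P" for a b
  proof -
    obtain p where p: "p \<in> Poly_Mapping.keys a" "p \<in> F"
      and pmax: "\<And>n. n \<in> Poly_Mapping.keys a \<Longrightarrow> n \<in> F \<Longrightarrow> \<phi> n \<le> \<phi> p"
      using lead[OF a] by blast
    obtain q where q: "q \<in> Poly_Mapping.keys b" "q \<in> F"
      and qmax: "\<And>n. n \<in> Poly_Mapping.keys b \<Longrightarrow> n \<in> F \<Longrightarrow> \<phi> n \<le> \<phi> q"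
      using lead[OF b] by blast
    have "Poly_Mapping.lookup (a * b) (p + q) = Poly_Mapping.lookup a p * Poly_Mapping.lookup b q"
    proof (rule lookup_mult_unique)
      fix m n assume mn: "m \<in> Poly_Mapping.keys a" "n \<in> Poly_Mapping.keys b" "m + n = p + q"
      then have "m \<in> F" "n \<in> F" using p(2) q(2) F by metis+
      then have "\<phi> m \<le> \<phi> p" "\<phi> n \<le> \<phi> q" using pmax qmax mn by auto
      moreover have "\<phi> m + \<phi> n = \<phi> p + \<phi> q" using mn(3) \<phi>(2) by metis
      ultimately have "\<phi> m = \<phi> p"
        by (metis add_le_cancel_left add_right_cancel antisym add_right_mono)
      then have "m = p" using \<phi>(1) by (simp add: inj_eq)
      then show "m = p \<and> n = q" using mn(3) by simp
    qed
    then have "p + q \<in> Poly_Mapping.keys (a * b)"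
      using p(1) q(1) by (simp add: in_keys_iff)
    then show ?thesis using P F p(2) q(2) by blast
  qed
  moreover have "(1 :: ('v, 'k) mpoly) \<notin> ?P"
    unfolding P by (simp add: F_def)
  ultimately show ?thesis
    unfolding prime_ideal_def using ideals.subspace_span by blast
qed

lemma prime_ideal_power:
  assumes "prime_ideal P" "a ^ n \<in> P"
  shows "a \<in> P"
  using assms(2)
proof (induction n)
  case 0
  have "c \<in> P" for c
    using ideals.subspace_scale[of P 1 c] 0 assms(1) by (simp add: prime_ideal_def)
  then show ?case by blast
next
  case (Suc n)
  then show ?case using assms(1) by (auto simp: prime_ideal_def)
qed

section \<open>Generators and syzygies of a linear resolution\<close>

text \<open>The generators are the entries of the matrix of $F_0 \to I$. Minimality makes them nonzero, so
  their degrees are at least \<open>alpha I\<close>, and the regularity bounds them by \<open>alpha I\<close>. The columns of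
  the matrix of $F_1 \to F_0$ generate the syzygies, and by the regularity again they are of
  degree at most \<open>alpha I + 1\<close>, which leaves degree at most one for their entries. Generation of the
  syzygies is expressed through its consequence for arbitrary ring elements \<open>h r\<close>: if these satisfy
  all linear syzygies, they satisfy all syzygies.\<close>

lemma linear_resolution_presentation:
  fixes I :: "('v::finite, 'k::field) mpoly set"
  assumes "has_linear_resolution I"
  obtains n and g :: "nat \<Rightarrow> ('v, 'k) mpoly"
  where "\<forall>r<n. g r \<in> I \<inter> homogeneous_part (alpha I)"
    and "\<forall>f\<in>I. \<exists>p. f = (\<Sum>r<n. p r * g r)"
    and "\<forall>h. (\<forall>c. (\<forall>r<n. \<forall>m\<in>Poly_Mapping.keys (c r). monom_degree m \<le> 1)
            \<longrightarrow> (\<Sum>r<n. c r * g r) = 0 \<longrightarrow> (\<Sum>r<n. c r * h r) = 0)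
        \<longrightarrow> (\<forall>p. (\<Sum>r<n. p r * g r) = 0 \<longrightarrow> (\<Sum>r<n. p r * h r) = 0)"
proof -
  from assms obtain b s \<epsilon> \<delta> where res: "minimal_graded_free_resolution I b s \<epsilon> \<delta>"
    and reg: "\<And>i j. graded_betti b s i j \<noteq> 0 \<Longrightarrow> int j - int i \<le> int (alpha I)"
    unfolding has_linear_resolution_def has_regularity_def by blast
  define \<delta>0 where "\<delta>0 = \<delta> 0"
  have \<epsilon>: "\<epsilon> \<in> carrier_mat 1 (b 0)" and \<delta>: "\<delta>0 \<in> carrier_mat (b 0) (b 1)"
    and grade\<epsilon>: "graded_mat (\<lambda>_. 0) (s 0) \<epsilon>" and grade\<delta>: "graded_mat (s 0) (s 1) \<delta>0"
    and I: "(\<lambda>v. v $ 0) ` mat_image \<epsilon> = I" and exact: "mat_image \<delta>0 = mat_kernel \<epsilon>"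
    and minimal: "\<And>l j. l < b 0 \<Longrightarrow> j < b 1 \<Longrightarrow> \<delta>0 $$ (l, j) \<in> ideals.span (range Var)"
    using res unfolding minimal_graded_free_resolution_def \<delta>0_def One_nat_def by auto
  have shift: "s i l \<le> alpha I + i" if "l < b i" for i l
  proof -
    have "graded_betti b s i (s i l) \<noteq> 0"
      using that unfolding graded_betti_def by (auto simp: card_eq_0_iff)
    from reg[OF this] show ?thesis by simp
  qed
  define g where "g r = \<epsilon> $$ (0, r)" for r
  have apply\<epsilon>: "(\<epsilon> *\<^sub>v v) $ 0 = (\<Sum>r<b 0. v $ r * g r)" if "v \<in> carrier_vec (b 0)" for v
    using \<epsilon> that by (simp add: g_def scalar_prod_def lessThan_atLeast0 mult.commute)
  have apply\<delta>: "(\<delta>0 *\<^sub>v v) $ r = (\<Sum>j<b 1. \<delta>0 $$ (r, j) * v $ j)"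
    if "v \<in> carrier_vec (b 1)" "r < b 0" for v r
    using \<delta> that by (simp add: scalar_prod_def lessThan_atLeast0)
  have kernel: "v \<in> mat_kernel \<epsilon> \<longleftrightarrow> v \<in> carrier_vec (b 0) \<and> (\<Sum>r<b 0. v $ r * g r) = 0" for v
  proof -
    have "\<epsilon> *\<^sub>v v = 0\<^sub>v 1 \<longleftrightarrow> (\<epsilon> *\<^sub>v v) $ 0 = 0"
      using \<epsilon> by (auto simp: vec_eq_iff)
    then show ?thesis using \<epsilon> apply\<epsilon> by (auto simp: mat_kernel_def)
  qed
  have pick: "(\<Sum>r<n. unit_vec n i $ r * h r) = h i" if "i < n" for n i and h :: "nat \<Rightarrow> ('v, 'k) mpoly"
  proof -
    have "(\<Sum>r<n. unit_vec n i $ r * h r) = (\<Sum>r<n. if r = i then h r else 0)"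
      by (rule sum.cong) (use that in auto)
    then show ?thesis using that by simp
  qed
  have image: "u \<in> I \<longleftrightarrow> (\<exists>v \<in> carrier_vec (b 0). u = (\<Sum>r<b 0. v $ r * g r))" for u
    using \<epsilon> apply\<epsilon> unfolding I[symmetric] mat_image_def by (auto simp: image_iff)
  have gI: "g r \<in> I" if "r < b 0" for r
    using that pick[OF that, of g] unfolding image by (metis unit_vec_carrier)
  (* Otherwise the r-th unit vector would be a syzygy, hence in the image of F_1 in F_0; but by
     minimality that image has no entry 1. *)
  have gnz: "g r \<noteq> 0" if r: "r < b 0" for r
  proof
    assume "g r = 0"
    then have "unit_vec (b 0) r \<in> mat_kernel \<epsilon>"
      unfolding kernel using pick[OF r, of g] by simp
    then obtain u where u: "u \<in> carrier_vec (b 1)" "unit_vec (b 0) r = \<delta>0 *\<^sub>v u"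
      using \<delta> unfolding exact[symmetric] mat_image_def by auto
    have "1 = (\<Sum>j<b 1. \<delta>0 $$ (r, j) * u $ j)"
      using apply\<delta>[OF u(1) r] r unfolding u(2)[symmetric] by simp
    also have "\<dots> \<in> ideals.span (range Var)"
      by (rule ideals.span_sum)
        (metis ideals.span_scale lessThan_iff minimal mult.commute r)
    finally have "(1 :: ('v, 'k) mpoly) \<in> ideals.span (range Var)" .
    then show False by (simp add: in_variable_ideal_iff)
  qed
  have g_hom: "g r \<in> homogeneous_part (s 0 r)" if "r < b 0" for r
    using grade\<epsilon> \<epsilon> gnz[OF that] that unfolding graded_mat_def g_def by auto
  have s0: "s 0 r = alpha I" if r: "r < b 0" for r
  proof (rule antisym)
    show "s 0 r \<le> alpha I" using shift[OF r] by simp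
    show "alpha I \<le> s 0 r"
      unfolding alpha_def by (rule Least_le) (use g_hom gI gnz r in blast)
  qed
  show thesis
  proof (rule that[of "b 0" g])
    show "\<forall>r<b 0. g r \<in> I \<inter> homogeneous_part (alpha I)" using gI g_hom s0 by fastforce
    show "\<forall>f\<in>I. \<exists>p. f = (\<Sum>r<b 0. p r * g r)"
    proof
      fix f assume "f \<in> I"
      then obtain v where "f = (\<Sum>r<b 0. v $ r * g r)" unfolding image by blast
      then show "\<exists>p. f = (\<Sum>r<b 0. p r * g r)" by (intro exI[of _ "($) v"])
    qed
  next
    show "\<forall>h. (\<forall>c. (\<forall>r<b 0. \<forall>m\<in>Poly_Mapping.keys (c r). monom_degree m \<le> 1)
            \<longrightarrow> (\<Sum>r<b 0. c r * g r) = 0 \<longrightarrow> (\<Sum>r<b 0. c r * h r) = 0)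
        \<longrightarrow> (\<forall>p. (\<Sum>r<b 0. p r * g r) = 0 \<longrightarrow> (\<Sum>r<b 0. p r * h r) = 0)"
    proof (intro allI impI)
      fix h p :: "nat \<Rightarrow> ('v, 'k) mpoly"
      assume lin: "\<forall>c. (\<forall>r<b 0. \<forall>m\<in>Poly_Mapping.keys (c r). monom_degree m \<le> 1)
            \<longrightarrow> (\<Sum>r<b 0. c r * g r) = 0 \<longrightarrow> (\<Sum>r<b 0. c r * h r) = 0"
        and p: "(\<Sum>r<b 0. p r * g r) = 0"
      have col: "(\<Sum>r<b 0. \<delta>0 $$ (r, j) * h r) = 0" if j: "j < b 1" for j
      proof (rule lin[rule_format])
        fix r m assume r: "r < b 0" and m: "m \<in> Poly_Mapping.keys (\<delta>0 $$ (r, j))"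
        moreover from m have "\<delta>0 $$ (r, j) \<noteq> 0" by auto
        ultimately have "s 0 r \<le> s 1 j" "\<delta>0 $$ (r, j) \<in> homogeneous_part (s 1 j - s 0 r)"
          using grade\<delta> \<delta> j unfolding graded_mat_def by auto
        then show "monom_degree m \<le> 1"
          using m shift[OF j] s0[OF r] by (auto simp: homogeneous_part_def)
      next
        have "\<delta>0 *\<^sub>v unit_vec (b 1) j \<in> mat_kernel \<epsilon>"
          using \<delta> unfolding exact[symmetric] mat_image_def by auto
        moreover have "(\<delta>0 *\<^sub>v unit_vec (b 1) j) $ r = \<delta>0 $$ (r, j)" if "r < b 0" for r
          using pick[OF j, of "\<lambda>j. \<delta>0 $$ (r, j)"] apply\<delta>[of "unit_vec (b 1) j" r] that
          by (simp add: mult.commute)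
        ultimately show "(\<Sum>r<b 0. \<delta>0 $$ (r, j) * g r) = 0"
          unfolding kernel by simp
      qed
      have "vec (b 0) p \<in> mat_kernel \<epsilon>"
        unfolding kernel using p by simp
      then obtain u where u: "u \<in> carrier_vec (b 1)" "vec (b 0) p = \<delta>0 *\<^sub>v u"
        using \<delta> unfolding exact[symmetric] mat_image_def by auto
      have pr: "p r = (\<Sum>j<b 1. \<delta>0 $$ (r, j) * u $ j)" if "r < b 0" for r
        using apply\<delta>[OF u(1) that] that unfolding u(2)[symmetric] by simp
      have ph: "p r * h r = (\<Sum>j<b 1. u $ j * (\<delta>0 $$ (r, j) * h r))" if "r < b 0" for r
        unfolding pr[OF that] sum_distrib_right by (rule sum.cong) (simp_all only: mult_ac)
      have "(\<Sum>r<b 0. p r * h r) = (\<Sum>r<b 0. \<Sum>j<b 1. u $ j * (\<delta>0 $$ (r, j) * h r))"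
        by (rule sum.cong) (auto simp only: ph lessThan_iff)
      also have "\<dots> = (\<Sum>j<b 1. u $ j * (\<Sum>r<b 0. \<delta>0 $$ (r, j) * h r))"
        unfolding sum_distrib_left by (rule sum.swap)
      also have "\<dots> = 0" using col by simp
      finally show "(\<Sum>r<b 0. p r * h r) = 0" .
    qed
  qed
qed

section \<open>Restriction of a polynomial to a set of monomials\<close>

definition restrict_keys :: "'a set \<Rightarrow> ('a \<Rightarrow>\<^sub>0 'b::zero) \<Rightarrow> ('a \<Rightarrow>\<^sub>0 'b)" where
  "restrict_keys A f = Poly_Mapping.mapp (\<lambda>m c. c when m \<in> A) f"

lemma lookup_restrict_keys:
  "Poly_Mapping.lookup (restrict_keys A f) m = (Poly_Mapping.lookup f m when m \<in> A)"
  by (auto simp: restrict_keys_def lookup_mapp when_def in_keys_iff)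

lemma keys_restrict_keys: "Poly_Mapping.keys (restrict_keys A f) = Poly_Mapping.keys f \<inter> A"
  by (auto simp: in_keys_iff lookup_restrict_keys when_def split: if_splits)

lemma restrict_keys_add:
  fixes f g :: "'a \<Rightarrow>\<^sub>0 'b::comm_monoid_add"
  shows "restrict_keys A (f + g) = restrict_keys A f + restrict_keys A g"
  by (rule poly_mapping_eqI) (simp add: lookup_restrict_keys lookup_add when_def)

lemma restrict_keys_sum:
  fixes f :: "'i \<Rightarrow> 'a \<Rightarrow>\<^sub>0 'b::comm_monoid_add"
  shows "restrict_keys A (\<Sum>i\<in>R. f i) = (\<Sum>i\<in>R. restrict_keys A (f i))"
  by (rule poly_mapping_eqI) (simp add: lookup_restrict_keys lookup_sum when_def)

lemma restrict_keys_decompose: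
  fixes f :: "'a \<Rightarrow>\<^sub>0 'b::comm_monoid_add"
  shows "f = restrict_keys A f + restrict_keys (- A) f"
  by (rule poly_mapping_eqI) (simp add: lookup_restrict_keys lookup_add when_def)

text \<open>Restriction to \<open>A\<close> is linear over those coefficients whose monomials do not move a monomial of
  \<open>g\<close> across the border of \<open>A\<close>.\<close>

lemma restrict_keys_mult:
  fixes f g :: "'a::comm_monoid_add \<Rightarrow>\<^sub>0 'b::comm_ring_1"
  assumes A: "\<And>p m. p \<in> Poly_Mapping.keys f \<Longrightarrow> m \<in> Poly_Mapping.keys g \<Longrightarrow> p + m \<in> A \<longleftrightarrow> m \<in> A"
  shows "restrict_keys A (f * g) = f * restrict_keys A g"
proof -
  have "Poly_Mapping.keys (f * restrict_keys A g) \<subseteq> A"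
    using keys_mult[of f "restrict_keys A g"] A by (fastforce simp: keys_restrict_keys)
  then have 1: "restrict_keys A (f * restrict_keys A g) = f * restrict_keys A g"
    by (intro poly_mapping_eqI) (auto simp: lookup_restrict_keys when_def in_keys_iff)
  have "Poly_Mapping.keys (f * restrict_keys (- A) g) \<inter> A = {}"
    using keys_mult[of f "restrict_keys (- A) g"] A by (fastforce simp: keys_restrict_keys)
  then have 2: "restrict_keys A (f * restrict_keys (- A) g) = 0"
    by (intro poly_mapping_eqI) (auto simp: lookup_restrict_keys when_def in_keys_iff)
  have "f * g = f * restrict_keys A g + f * restrict_keys (- A) g"
    by (metis restrict_keys_decompose distrib_left)
  then show ?thesis by (simp add: restrict_keys_add 1 2)
qed

section \<open>Edge monomials\<close>

definition edge_monomial :: "('v \<Rightarrow> nat) \<Rightarrow> 'v \<Rightarrow> 'v \<Rightarrow> ('v \<Rightarrow>\<^sub>0 nat)" where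
  "edge_monomial w x y = Poly_Mapping.single x 1 + Poly_Mapping.single y (w y)"

lemma edge_generator: "Var x * Var y ^ w y = Poly_Mapping.single (edge_monomial w x y) 1"
  by (simp add: edge_monomial_def Var_power mult_single) (simp add: Var_def mult_single)

lemma monom_degree_edge_monomial: "monom_degree (edge_monomial w x y) = Suc (w y)"
  by (simp add: edge_monomial_def monom_degree_add)

lemma edge_generator_in_ideal:
  "(x, y) \<in> E \<Longrightarrow> Poly_Mapping.single (edge_monomial w x y) 1 \<in> oriented_edge_ideal E w"
  unfolding oriented_edge_ideal_def by (rule ideals.span_base) (auto simp flip: edge_generator)

lemma keys_oriented_edge_ideal:
  assumes f: "f \<in> oriented_edge_ideal E w" and m: "m \<in> Poly_Mapping.keys f"
  obtains p x y where "(x, y) \<in> E" "m = p + edge_monomial w x y"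
proof -
  have "Poly_Mapping.keys f \<subseteq> {m. \<exists>p x y. (x, y) \<in> E \<and> m = p + edge_monomial w x y}"
  proof (rule keys_ideal_span[OF _ _ f[unfolded oriented_edge_ideal_def]])
    fix m p :: "'a \<Rightarrow>\<^sub>0 nat"
    assume "m \<in> {m. \<exists>p x y. (x, y) \<in> E \<and> m = p + edge_monomial w x y}"
    then show "p + m \<in> {m. \<exists>p x y. (x, y) \<in> E \<and> m = p + edge_monomial w x y}"
      by clarsimp (metis add.assoc)
  next
    fix b :: "('a, 'b) mpoly" assume "b \<in> {Var x * Var y ^ w y |x y. (x, y) \<in> E}"
    then obtain x y where "(x, y) \<in> E" "b = Poly_Mapping.single (edge_monomial w x y) 1"
      using edge_generator[of _ _ w] by auto
    then show "Poly_Mapping.keys b \<subseteq> {m. \<exists>p x y. (x, y) \<in> E \<and> m = p + edge_monomial w x y}"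
      by simp (metis add_0)
  qed
  then show thesis using m that by blast
qed

text \<open>If one edge monomial divides another, both ends of its edge are among the ends of the other
  edge. As no two edges are antiparallel, the two edges agree.\<close>

lemma edge_monomials_antichain:
  assumes orient: "\<And>x y. (x, y) \<in> E \<Longrightarrow> (y, x) \<notin> E" and w: "w y \<ge> 1"
    and E: "(x, y) \<in> E" "(a, b) \<in> E" and eq: "edge_monomial w a b = p + edge_monomial w x y"
  shows "x = a \<and> y = b \<and> p = 0"
proof -
  have lk: "Poly_Mapping.lookup (edge_monomial w a b) z
      = Poly_Mapping.lookup p z + Poly_Mapping.lookup (edge_monomial w x y) z" for z
    by (simp add: eq lookup_add)
  have "x \<in> {a, b}" "y \<in> {a, b}"
    using lk[of x] lk[of y] w
    by (auto simp: edge_monomial_def lookup_add lookup_single when_def split: if_splits)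
  moreover have "x \<noteq> y" using orient E(1) by blast
  ultimately have "x = a \<and> y = b" using orient E by auto
  then show ?thesis using eq by simp
qed

text \<open>Let \<open>I\<close> be generated in degree \<open>e\<close>. An edge monomial is divisible by a monomial \<open>m\<close>
  of degree \<open>e\<close> that occurs in an element of \<open>I\<close>, and \<open>m\<close> is divisible by an edge monomial. By the
  antichain property all three coincide, so every edge monomial has degree \<open>e\<close>.\<close>

lemma alpha_oriented_edge_ideal:
  fixes w :: "'v::finite \<Rightarrow> nat"
  assumes orient: "\<And>x y. (x, y) \<in> E \<Longrightarrow> (y, x) \<notin> E" and w: "\<And>x. w x \<ge> 1"
    and equi: "equigenerated (oriented_edge_ideal E w :: ('v, 'k::field) mpoly set)"
    and edge: "(a, b) \<in> E"
  shows "alpha (oriented_edge_ideal E w :: ('v, 'k) mpoly set) = Suc (w b)"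
proof -
  let ?I = "oriented_edge_ideal E w :: ('v, 'k) mpoly set"
  obtain e B where B: "B \<subseteq> homogeneous_part e" and I: "?I = ideals.span B"
    using equi unfolding equigenerated_def by blast
  have ge: "e \<le> monom_degree m" if f: "f \<in> ?I" "m \<in> Poly_Mapping.keys f" for f m
  proof -
    have "Poly_Mapping.keys f \<subseteq> {m. e \<le> monom_degree m}"
      by (rule keys_ideal_span[OF _ _ f(1)[unfolded I]])
        (use B in \<open>auto simp: homogeneous_part_def monom_degree_add\<close>)
    then show ?thesis using f(2) by blast
  qed
  have gen: "Poly_Mapping.single (edge_monomial w a b) 1 \<in> ?I"
    using edge by (rule edge_generator_in_ideal)
  have e: "e = Suc (w b)"
  proof -
    let ?U = "{m. \<exists>p. \<exists>f\<in>B. \<exists>m'\<in>Poly_Mapping.keys f. m = p + m'}"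
    have "Poly_Mapping.keys (Poly_Mapping.single (edge_monomial w a b) (1 :: 'k)) \<subseteq> ?U"
    proof (rule keys_ideal_span[OF _ _ gen[unfolded I]])
      fix m p :: "'v \<Rightarrow>\<^sub>0 nat" assume "m \<in> ?U"
      then show "p + m \<in> ?U" by clarsimp (metis add.assoc)
    next
      fix f assume "f \<in> B"
      then show "Poly_Mapping.keys f \<subseteq> ?U" by (auto intro!: exI[of _ 0])
    qed
    then obtain p f m where f: "f \<in> B" "m \<in> Poly_Mapping.keys f" and p: "edge_monomial w a b = p + m"
      by auto
    have "f \<in> ?I" unfolding I using f(1) by (rule ideals.span_base)
    then obtain q x y where q: "(x, y) \<in> E" "m = q + edge_monomial w x y"
      using f(2) by (rule keys_oriented_edge_ideal)
    have "edge_monomial w a b = (p + q) + edge_monomial w x y"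
      by (simp add: p q(2) add.assoc)
    from edge_monomials_antichain[OF orient w q(1) edge this]
    have "monom_degree (p + q) = 0" by (simp add: monom_degree_zero_iff)
    then have "p = 0" by (simp add: monom_degree_add monom_degree_zero_iff)
    then have "m = edge_monomial w a b" using p by simp
    moreover have "monom_degree m = e" using B f by (auto simp: homogeneous_part_def)
    ultimately show ?thesis by (simp add: monom_degree_edge_monomial)
  qed
  show ?thesis
    unfolding alpha_def
  proof (rule Least_equality)
    show "\<exists>f\<in>homogeneous_part (Suc (w b)). f \<in> ?I \<and> f \<noteq> 0"
      using gen by (intro bexI[of _ "Poly_Mapping.single (edge_monomial w a b) 1"])
        (auto simp: homogeneous_part_def monom_degree_edge_monomial simp flip: keys_eq_empty)
  next
    fix d assume "\<exists>f\<in>homogeneous_part d. f \<in> ?I \<and> f \<noteq> 0"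
    then obtain f where f: "f \<in> homogeneous_part d" "f \<in> ?I" "f \<noteq> 0" by blast
    then obtain m where "m \<in> Poly_Mapping.keys f" using keys_eq_empty by blast
    then show "Suc (w b) \<le> d" using ge[OF f(2)] f(1) e by (auto simp: homogeneous_part_def)
  qed
qed

section \<open>Linear resolutions force a common head\<close>

text \<open>The reason why linear syzygies respect heads. Suppose that the product of $x y^{w(y)}$ and a
  monomial \<open>p\<close> of degree at most one is a multiple of $i j^{w(j)}$ with \<open>j \<noteq> y\<close>. The exponent of
  \<open>j\<close> must be at least two, so \<open>x = j\<close> and \<open>p = j\<close>; then only \<open>y\<close> is left for the variable \<open>i\<close>, and
  the edges \<open>(j, y)\<close> and \<open>(y, j)\<close> are antiparallel.\<close>

lemma linear_multiple_determines_head: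
  assumes orient: "\<And>x y. (x, y) \<in> E \<Longrightarrow> (y, x) \<notin> E" and w: "w j \<ge> 2" "w y \<ge> 1"
    and E: "(x, y) \<in> E" "(i, j) \<in> E" and p: "monom_degree p \<le> 1"
    and eq: "p + edge_monomial w x y = q + edge_monomial w i j"
  shows "y = j"
proof (rule ccontr)
  assume yj: "y \<noteq> j"
  have ij: "i \<noteq> j" and xy: "x \<noteq> y" using orient E by blast+
  have lk: "Poly_Mapping.lookup p z + Poly_Mapping.lookup (edge_monomial w x y) z
      = Poly_Mapping.lookup q z + Poly_Mapping.lookup (edge_monomial w i j) z" for z
    using eq by (metis lookup_add)
  have pz: "Poly_Mapping.lookup p j + Poly_Mapping.lookup p z \<le> 1" if "z \<noteq> j" for z
    using lookup_add_le_monom_degree[of j z p] that p by simp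
  have xj: "x = j" and pj: "Poly_Mapping.lookup p j = 1"
    using lk[of j] pz[OF ij] yj ij w
    by (auto simp: edge_monomial_def lookup_add lookup_single when_def split: if_splits)
  have "i = y"
    using lk[of i] pz[OF ij] xj pj ij
    by (auto simp: edge_monomial_def lookup_add lookup_single when_def split: if_splits)
  then show False using orient E xj by blast
qed

text \<open>Let \<open>A\<close> be the set of multiples of edge monomials with head \<open>j\<close>, and let the generators \<open>g r\<close>
  be replaced by their restrictions \<open>h r\<close> to \<open>A\<close>. By the previous lemma the \<open>h r\<close> satisfy all linear
  syzygies of the \<open>g r\<close>, hence all syzygies: mapping \<open>g r\<close> to \<open>h r\<close> is a well-defined
  module homomorphism \<open>\<pi>\<close> on \<open>I\<close>. For edge monomials \<open>u\<close> with head \<open>j\<close> and \<open>v\<close> with head \<open>l\<close> this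
  gives \<open>v \<pi>(u) = \<pi>(u v) = u \<pi>(v)\<close>. The coefficient of \<open>u v\<close> is \<open>1\<close> on the left, because \<open>\<pi>(u)\<close> has
  coefficient \<open>1\<close> at \<open>u\<close>, and \<open>0\<close> on the right, because \<open>\<pi>(v)\<close> has only monomials in \<open>A\<close> and
  \<open>v \<notin> A\<close>.\<close>

lemma linear_resolution_common_head:
  fixes w :: "'v::finite \<Rightarrow> nat"
  assumes orient: "\<And>x y. (x, y) \<in> E \<Longrightarrow> (y, x) \<notin> E"
    and w: "\<And>x y. (x, y) \<in> E \<Longrightarrow> w y = W" "W \<ge> 2"
    and alpha: "alpha (oriented_edge_ideal E w :: ('v, 'k::field) mpoly set) = Suc W"
    and lin: "has_linear_resolution (oriented_edge_ideal E w :: ('v, 'k) mpoly set)"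
    and edges: "(a, j) \<in> E" "(b, l) \<in> E"
  shows "j = l"
proof (rule ccontr)
  assume jl: "j \<noteq> l"
  let ?I = "oriented_edge_ideal E w :: ('v, 'k) mpoly set"
  obtain n and g :: "nat \<Rightarrow> ('v, 'k) mpoly" where
    g: "\<forall>r<n. g r \<in> ?I \<inter> homogeneous_part (alpha ?I)"
    and g_gen: "\<forall>f\<in>?I. \<exists>p. f = (\<Sum>r<n. p r * g r)"
    and g_syz: "\<forall>h. (\<forall>c. (\<forall>r<n. \<forall>m\<in>Poly_Mapping.keys (c r). monom_degree m \<le> 1)
            \<longrightarrow> (\<Sum>r<n. c r * g r) = 0 \<longrightarrow> (\<Sum>r<n. c r * h r) = 0)
        \<longrightarrow> (\<forall>p. (\<Sum>r<n. p r * g r) = 0 \<longrightarrow> (\<Sum>r<n. p r * h r) = 0)"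
    by (rule linear_resolution_presentation[OF lin])
  define A where "A = {m. \<exists>i q. (i, j) \<in> E \<and> m = q + edge_monomial w i j}"
  have A_up: "q + m \<in> A" if "m \<in> A" for m q
    using that unfolding A_def by clarsimp (metis add.assoc)
  have A_edge: "edge_monomial w i j \<in> A" if "(i, j) \<in> E" for i
    unfolding A_def using that by (auto intro!: exI[of _ 0])
  have A_iff: "p + edge_monomial w x y \<in> A \<longleftrightarrow> y = j" if "(x, y) \<in> E" "monom_degree p \<le> 1" for p x y
    using linear_multiple_determines_head[OF orient _ _ that(1) _ that(2), of w j] w that(1) A_edge A_up
    unfolding A_def by fastforce
  have g_keys: "\<exists>x y. (x, y) \<in> E \<and> m = edge_monomial w x y"
    if r: "r < n" and m: "m \<in> Poly_Mapping.keys (g r)" for r m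
  proof -
    obtain p x y where p: "(x, y) \<in> E" "m = p + edge_monomial w x y"
      using g r m by (blast elim: keys_oriented_edge_ideal)
    have "monom_degree m = Suc W" using g r m alpha by (auto simp: homogeneous_part_def)
    then have "monom_degree p = 0"
      using w(1)[OF p(1)] by (simp add: p(2) monom_degree_add monom_degree_edge_monomial)
    then show ?thesis using p by (auto simp: monom_degree_zero_iff)
  qed
  define h where "h r = restrict_keys A (g r)" for r
  have h_syz: "(\<Sum>r<n. p r * h r) = 0" if "(\<Sum>r<n. p r * g r) = 0" for p
  proof (rule g_syz[rule_format, OF _ that])
    fix c :: "nat \<Rightarrow> ('v, 'k) mpoly"
    assume c: "\<And>r m. r < n \<Longrightarrow> m \<in> Poly_Mapping.keys (c r) \<Longrightarrow> monom_degree m \<le> 1"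
      and syz: "(\<Sum>r<n. c r * g r) = 0"
    have "c r * h r = restrict_keys A (c r * g r)" if r: "r < n" for r
    proof -
      have "p + m \<in> A \<longleftrightarrow> m \<in> A"
        if p: "p \<in> Poly_Mapping.keys (c r)" and m: "m \<in> Poly_Mapping.keys (g r)" for p m
      proof -
        obtain x y where xy: "(x, y) \<in> E" "m = edge_monomial w x y"
          using g_keys[OF r m] by blast
        show ?thesis
          using A_iff[OF xy(1) c[OF r p]] A_iff[OF xy(1), of 0] xy(2)
          by (simp add: monom_degree_zero)
      qed
      then show ?thesis unfolding h_def by (rule restrict_keys_mult[symmetric])
    qed
    then have "(\<Sum>r<n. c r * h r) = restrict_keys A (\<Sum>r<n. c r * g r)"
      unfolding restrict_keys_sum by (intro sum.cong) auto
    also have "\<dots> = 0"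
      unfolding syz by (rule poly_mapping_eqI) (simp add: lookup_restrict_keys)
    finally show "(\<Sum>r<n. c r * h r) = 0" .
  qed
  define u v where "u = edge_monomial w a j" and "v = edge_monomial w b l"
  obtain p where p: "Poly_Mapping.single u 1 = (\<Sum>r<n. p r * g r)"
    using g_gen edge_generator_in_ideal[OF edges(1)] unfolding u_def by blast
  obtain q where q: "Poly_Mapping.single v 1 = (\<Sum>r<n. q r * g r)"
    using g_gen edge_generator_in_ideal[OF edges(2)] unfolding v_def by blast
  (* X and Y are the images of u and v under the homomorphism that takes g r to h r. *)
  define X Y where "X = (\<Sum>r<n. p r * h r)" and "Y = (\<Sum>r<n. q r * h r)"
  have expand: "(\<Sum>r<n. (Poly_Mapping.single v 1 * p r - Poly_Mapping.single u 1 * q r) * f r)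
      = Poly_Mapping.single v 1 * (\<Sum>r<n. p r * f r) - Poly_Mapping.single u 1 * (\<Sum>r<n. q r * f r)" for f
    by (simp only: sum_subtractf sum_distrib_left left_diff_distrib mult.assoc)
  have "Poly_Mapping.single v 1 * X - Poly_Mapping.single u 1 * Y = 0"
    unfolding X_def Y_def expand[symmetric]
    by (rule h_syz) (unfold expand p[symmetric] q[symmetric], simp only: mult.commute diff_self)
  then have "Poly_Mapping.lookup (Poly_Mapping.single v 1 * X) (v + u)
      = Poly_Mapping.lookup (Poly_Mapping.single u 1 * Y) (u + v)"
    by (simp add: add.commute)
  then have XY: "Poly_Mapping.lookup X u = Poly_Mapping.lookup Y v"
    by (simp only: lookup_monomial_times)
  have "Poly_Mapping.keys Y \<subseteq> A"
  proof
    fix m assume "m \<in> Poly_Mapping.keys Y"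
    then obtain r where "m \<in> Poly_Mapping.keys (q r * h r)"
      using keys_sum[of "\<lambda>r. q r * h r" "{..<n}"] unfolding Y_def by auto
    then obtain s t where "t \<in> Poly_Mapping.keys (h r)" "m = s + t"
      using keys_mult[of "q r" "h r"] by blast
    then show "m \<in> A" using A_up by (simp add: h_def keys_restrict_keys)
  qed
  moreover have "v \<notin> A"
    using A_iff[OF edges(2), of 0] jl by (simp add: v_def monom_degree_zero)
  ultimately have "Poly_Mapping.lookup Y v = 0" by (auto simp: in_keys_iff)
  moreover have "Poly_Mapping.lookup X u = 1"
  proof -
    (* Z is what the restriction to A removes from u. Its monomials are multiples of edge monomials
       outside A, and u is not among these by the antichain property. *)
    define Z where "Z = (\<Sum>r<n. p r * restrict_keys (- A) (g r))"
    have "Poly_Mapping.single u 1 = X + Z"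
      unfolding X_def Z_def p h_def sum.distrib[symmetric] distrib_left[symmetric]
      by (simp flip: restrict_keys_decompose)
    then have "1 = Poly_Mapping.lookup X u + Poly_Mapping.lookup Z u"
      by (metis lookup_add lookup_single_eq)
    moreover have "u \<notin> Poly_Mapping.keys Z"
    proof
      assume "u \<in> Poly_Mapping.keys Z"
      then obtain r where r: "r < n" "u \<in> Poly_Mapping.keys (p r * restrict_keys (- A) (g r))"
        using keys_sum[of "\<lambda>r. p r * restrict_keys (- A) (g r)" "{..<n}"] unfolding Z_def by auto
      then obtain s t where t: "t \<in> Poly_Mapping.keys (g r)" "t \<notin> A" "u = s + t"
        using keys_mult[of "p r" "restrict_keys (- A) (g r)"] by (auto simp: keys_restrict_keys)
      obtain x y where xy: "(x, y) \<in> E" "t = edge_monomial w x y" using g_keys[OF r(1) t(1)] by blast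
      have wy: "w y \<ge> 1" using w xy(1) by fastforce
      have "x = a \<and> y = j \<and> s = 0"
      proof (rule edge_monomials_antichain[of E w y x a j s])
        show "edge_monomial w a j = s + edge_monomial w x y" using t(3) xy(2) by (simp add: u_def)
      qed (fact orient wy xy(1) edges(1))+
      then have "t = u" using xy(2) by (simp add: u_def)
      then show False using t(2) A_edge[OF edges(1)] by (simp add: u_def)
    qed
    ultimately show ?thesis by (simp add: in_keys_iff)
  qed
  ultimately show False using XY by simp
qed

section \<open>The v-number of the powers of a star ideal\<close>

lemma subspace_ideal_power: "ideals.subspace (ideal_power I k)"
  by (cases k) (simp_all add: ideal_product_def ideals.subspace_span)

lemma subspace_colon:
  assumes "ideals.subspace J"
  shows "ideals.subspace (colon J f)"
proof (rule ideals.subspaceI)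
  show "0 \<in> colon J f"
    using ideals.subspace_0[OF assms] by (simp add: colon_def)
  show "x + y \<in> colon J f" if "x \<in> colon J f" "y \<in> colon J f" for x y
    using ideals.subspace_add[OF assms] that by (simp add: colon_def distrib_right)
  show "c * x \<in> colon J f" if "x \<in> colon J f" for c x
    using ideals.subspace_scale[OF assms, of "x * f" c] that by (simp add: colon_def)
qed

text \<open>The exponent is written as \<open>Suc k\<close>, so the value is \<open>(W + 1) (k + 1) - 1\<close>.\<close>

lemma v_number_power_star_ideal:
  fixes y :: "'v::finite" and N :: "'v set" and W :: nat
  defines "I \<equiv> ideals.span {Var x * Var y ^ W |x. x \<in> N} :: ('v, 'k::field) mpoly set"
  assumes N: "N \<noteq> {}" "y \<notin> N"
  shows "v_number (ideal_power I (Suc k)) = W * Suc k + k"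
proof -
  let ?J = "ideal_power I (Suc k)"
  obtain i where i: "i \<in> N" using N(1) by blast
  have gen: "Var x * Var y ^ W \<in> I" if "x \<in> N" for x
    unfolding I_def using that by (auto intro: ideals.span_base)
  have gen_monomial: "(Var x * Var y ^ W :: ('v, 'k) mpoly)
      = Poly_Mapping.single (Poly_Mapping.single x 1 + Poly_Mapping.single y W) 1" for x
    by (simp add: Var_power) (simp add: Var_def mult_single)
  (* The degree in the variables of N. It is at least one on I, whence at least k + 1 on the power;
     as f below has only k of it, every h in the colon ideal must supply the missing one. *)
  define \<omega> where "\<omega> m = (\<Sum>x\<in>N. Poly_Mapping.lookup m x)" for m :: "'v \<Rightarrow>\<^sub>0 nat"
  have \<omega>_add: "\<omega> (m + m') = \<omega> m + \<omega> m'" for m m'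
    by (simp add: \<omega>_def lookup_add sum.distrib)
  have \<omega>_single: "\<omega> (Poly_Mapping.single x n) = (if x \<in> N then n else 0)" for x n
    by (simp add: \<omega>_def lookup_single when_def)
  have I_keys: "Suc W \<le> monom_degree m \<and> 1 \<le> \<omega> m" if f: "f \<in> I" "m \<in> Poly_Mapping.keys f" for f m
  proof -
    have "Poly_Mapping.keys f \<subseteq> {m. Suc W \<le> monom_degree m \<and> 1 \<le> \<omega> m}"
      by (rule keys_ideal_span[OF _ _ f(1)[unfolded I_def]])
        (auto simp: gen_monomial monom_degree_add \<omega>_add \<omega>_single)
    then show ?thesis using f(2) by blast
  qed
  have J_degree: "Suc W * Suc k \<le> monom_degree m" if "f \<in> ?J" "m \<in> Poly_Mapping.keys f" for f m
    by (rule keys_ideal_power[OF _ _ that]) (use I_keys monom_degree_add in auto)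
  have J_\<omega>: "1 * Suc k \<le> \<omega> m" if "f \<in> ?J" "m \<in> Poly_Mapping.keys f" for f m
    by (rule keys_ideal_power[OF _ _ that]) (use I_keys \<omega>_add in auto)
  show ?thesis
    unfolding v_number_def
  proof (rule Least_equality)
    define m0 where "m0 = Poly_Mapping.single y (W * Suc k) + Poly_Mapping.single i k"
    define f where "f = (Poly_Mapping.single m0 1 :: ('v, 'k) mpoly)"
    have f_hom: "f \<in> homogeneous_part (W * Suc k + k)"
      by (simp add: f_def m0_def homogeneous_part_def monom_degree_add)
    have colon: "colon ?J f = ideals.span (Var ` N)"
    proof
      show "ideals.span (Var ` N) \<subseteq> colon ?J f"
      proof (rule ideals.span_minimal)
        show "ideals.subspace (colon ?J f)" by (intro subspace_colon subspace_ideal_power)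
        show "Var ` N \<subseteq> colon ?J f"
        proof
          fix z :: "('v, 'k) mpoly" assume "z \<in> Var ` N"
          then obtain x where x: "x \<in> N" "z = Var x" by blast
          have f: "f = Var y ^ W * (Var i * Var y ^ W) ^ k"
          proof -
            have "f = Var y ^ (W * Suc k) * Var i ^ k"
              by (simp add: f_def m0_def Var_power mult_single)
            then show ?thesis by (simp only: mult_Suc_right power_add power_mult power_mult_distrib mult_ac)
          qed
          have "z * f = (Var x * Var y ^ W) * (Var i * Var y ^ W) ^ k"
            by (simp only: x(2) f mult_ac)
          also have "\<dots> \<in> ?J"
            using gen[OF x(1)] power_in_ideal_power[OF gen[OF i], of k]
            by (auto simp: ideal_product_def intro!: ideals.span_base)
          finally show "z \<in> colon ?J f" by (simp add: colon_def)
        qed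
      qed
      show "colon ?J f \<subseteq> ideals.span (Var ` N)"
      proof
        fix h assume "h \<in> colon ?J f"
        then have h: "f * h \<in> ?J" by (simp add: colon_def mult.commute)
        have "\<exists>x\<in>N. Poly_Mapping.lookup m x \<noteq> 0" if m: "m \<in> Poly_Mapping.keys h" for m
        proof -
          have "m0 + m \<in> Poly_Mapping.keys (f * h)"
            using m by (simp only: in_keys_iff f_def lookup_monomial_times not_False_eq_True)
          from J_\<omega>[OF h this] have "1 \<le> \<omega> m"
            using N(2) i by (simp add: m0_def \<omega>_add \<omega>_single)
          then show ?thesis by (cases "\<exists>x\<in>N. Poly_Mapping.lookup m x \<noteq> 0") (simp_all add: \<omega>_def)
        qed
        then show "h \<in> ideals.span (Var ` N)" by (simp add: in_variable_ideal_iff)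
      qed
    qed
    then have "colon ?J f \<in> Ass ?J"
      using prime_variable_ideal[of N] unfolding Ass_def by auto
    then show "\<exists>f\<in>homogeneous_part (W * Suc k + k). \<exists>P\<in>Ass ?J. colon ?J f = P"
      using f_hom by blast
  next
    fix d assume "\<exists>f\<in>homogeneous_part d. \<exists>P\<in>Ass ?J. colon ?J f = P"
    then obtain f where f: "f \<in> homogeneous_part d" and prime: "prime_ideal (colon ?J f)"
      unfolding Ass_def by auto
    have "f \<noteq> 0"
    proof
      assume "f = 0"
      then have "colon ?J f = UNIV"
        using ideals.subspace_0[OF subspace_ideal_power[of I "Suc k"]] by (simp add: colon_def del: ideal_power.simps)
      then show False using prime by (simp add: prime_ideal_def)
    qed
    then obtain m where m: "m \<in> Poly_Mapping.keys f" using keys_eq_empty by blast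
    have "(Var i * Var y ^ W) ^ Suc k \<in> colon ?J f"
      unfolding colon_def mem_Collect_eq mult.commute[of _ f]
      by (intro ideals.subspace_scale subspace_ideal_power power_in_ideal_power gen i)
    then have "Var i * Var y ^ W \<in> colon ?J f" by (rule prime_ideal_power[OF prime])
    then have "Var i \<in> colon ?J f \<or> Var y ^ W \<in> colon ?J f"
      using prime unfolding prime_ideal_def by blast
    then obtain z where "Var z \<in> colon ?J f" using prime_ideal_power[OF prime] by blast
    then have z: "Poly_Mapping.single (Poly_Mapping.single z 1) 1 * f \<in> ?J"
      by (simp add: colon_def Var_def del: ideal_power.simps)
    have "Poly_Mapping.single z 1 + m \<in> Poly_Mapping.keys (Poly_Mapping.single (Poly_Mapping.single z 1) 1 * f)"
      using m by (simp only: in_keys_iff lookup_monomial_times not_False_eq_True)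
    from J_degree[OF z this] have "Suc W * Suc k \<le> 1 + monom_degree m"
      by (simp add: monom_degree_add)
    moreover have "monom_degree m = d" using f m by (simp add: homogeneous_part_def)
    ultimately show "W * Suc k + k \<le> d" by simp
  qed
qed

theorem theorem4p13:
  fixes G :: "'v::finite set set" and E :: "('v \<times> 'v) set" and w :: "'v \<Rightarrow> nat"
    and I :: "('v, 'k::field) mpoly set"
  assumes "weighted_oriented_graph G E w"
    and "connected_graph G"
    and "I = oriented_edge_ideal E w"
    and "I \<noteq> edge_ideal G"
    and "has_linear_resolution I"
  shows "\<forall>k\<ge>1. int (v_number (ideal_power I k)) = int (alpha I) * int k - 1"
proof -
  have orient: "(y, x) \<notin> E" if "(x, y) \<in> E" for x y
    using assms(1) that unfolding weighted_oriented_graph_def by blast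
  have w: "w x \<ge> 1" for x
    using assms(1) unfolding weighted_oriented_graph_def by blast
  have G: "G = {{x, y} |x y. (x, y) \<in> E}"
    using assms(1) unfolding weighted_oriented_graph_def by blast
  have lin: "has_linear_resolution (oriented_edge_ideal E w :: ('v, 'k) mpoly set)"
    using assms(5) unfolding assms(3) .
  have equi: "equigenerated (oriented_edge_ideal E w :: ('v, 'k) mpoly set)"
    using lin unfolding has_linear_resolution_def by blast
  have alpha: "alpha I = Suc (w y)" if "(x, y) \<in> E" for x y
    unfolding assms(3) by (rule alpha_oriented_edge_ideal[OF _ w equi that]) (rule orient)
  (* If all heads had weight 1, the two edge ideals would have the same generators. *)
  have "\<exists>x y. (x, y) \<in> E \<and> w y \<noteq> 1"
  proof (rule ccontr)
    assume "\<not> ?thesis"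
    then have one: "w y = 1" if "(x, y) \<in> E" for x y using that by blast
    have "{Var x * Var y ^ w y |x y. (x, y) \<in> E} = {Var x * Var y :: ('v, 'k) mpoly |x y. {x, y} \<in> G}"
    proof
      show "{Var x * Var y ^ w y |x y. (x, y) \<in> E} \<subseteq> {Var x * Var y :: ('v, 'k) mpoly |x y. {x, y} \<in> G}"
        using one unfolding G by force
      show "{Var x * Var y :: ('v, 'k) mpoly |x y. {x, y} \<in> G} \<subseteq> {Var x * Var y ^ w y |x y. (x, y) \<in> E}"
      proof
        fix f :: "('v, 'k) mpoly" assume "f \<in> {Var x * Var y |x y. {x, y} \<in> G}"
        then obtain x y where f: "f = Var x * Var y" and "{x, y} \<in> G" by blast
        then consider "(x, y) \<in> E" | "(y, x) \<in> E" unfolding G by (auto simp: doubleton_eq_iff)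
        then show "f \<in> {Var x * Var y ^ w y |x y. (x, y) \<in> E}"
        proof cases
          case 1
          then have "f = Var x * Var y ^ w y" using f one by simp
          then show ?thesis using 1 by blast
        next
          case 2
          then have "f = Var y * Var x ^ w x" using f one by (simp add: mult.commute)
          then show ?thesis using 2 by blast
        qed
      qed
    qed
    then show False using assms(3,4) by (simp add: oriented_edge_ideal_def edge_ideal_def)
  qed
  then obtain i y where iy: "(i, y) \<in> E" "w y \<noteq> 1" by blast
  have W: "w z = w y" if "(x, z) \<in> E" for x z
    using alpha[OF that] alpha[OF iy(1)] by simp
  have W2: "w y \<ge> 2" using w[of y] iy(2) by linarith
  have head: "z = y" if "(x, z) \<in> E" for x z
    by (rule linear_resolution_common_head[OF _ _ W2 alpha[OF iy(1), unfolded assms(3)] lin that iy(1)])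
      (fact orient, fact W)
  define N where "N = {x. (x, y) \<in> E}"
  have N: "N \<noteq> {}" "y \<notin> N" using iy(1) orient by (auto simp: N_def)
  have "{Var x * Var z ^ w z |x z. (x, z) \<in> E} = {Var x * Var y ^ w y :: ('v, 'k) mpoly |x. x \<in> N}"
    using head unfolding N_def by blast
  then have I: "I = ideals.span {Var x * Var y ^ w y |x. x \<in> N}"
    by (simp add: assms(3) oriented_edge_ideal_def)
  show ?thesis
  proof (intro allI impI)
    fix k :: nat assume "k \<ge> 1"
    then obtain k' where k: "k = Suc k'" by (cases k) auto
    have "v_number (ideal_power I k) = w y * Suc k' + k'"
      unfolding k I by (rule v_number_power_star_ideal[OF N])
    then show "int (v_number (ideal_power I k)) = int (alpha I) * int k - 1"
      by (simp add: alpha[OF iy(1)] k algebra_simps)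
  qed
qed

end
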